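(* Let $p(x,y,z)$ be a polynomial with real coefficients in $(x,y,z)\in\mathbb{R}^3$. Let $(x^*,y^*,z^* )\in\mathbb{R}^3$ be a local minimum point of the polynomial $p(x,y,z)$, and at the same time let $(x^*,y^*,z^* )$ be a local minimum point in the problem $$x\to\min;\quad p(x,y,z)=p(x^*,y^*,z^* ).$$ Then $(x^*,y^*,z^* )$ is a local minimum point in the problem $$x\to\min;\quad \frac{\partial p(x,y,z)}{\partial x}=0,\ \frac{\partial p(x,y,z)}{\partial y}=0,\ \frac{\partial p(x,y,z)}{\partial z}=0 .$$
   Context: A problem written "$f\to\min;$ (constraints)" means minimizing $f$ over the feasible set $S\subseteq\mathbb{R}^3$ of all points satisfying the constraints. A local minimum point in this problem is a point $w^*\in S$ for which there is a neighborhood $V$ of $w^*$ in $\mathbb{R}^3$ with $f(w)\ge f(w^* )$ for all $w\in S\cap V$. A local minimum point of a polynomial $p$ is a local minimum point of the unconstrained problem ($S=\mathbb{R}^3$). *)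

theory Defs
  imports "HOL-Analysis.Analysis"
begin

text \<open>
  The point \<open>(x, y, z)\<close> is the vector \<open>w :: real ^ 3\<close> with \<open>x = w $ 1\<close>, \<open>y = w $ 2\<close>, \<open>z = w $ 3\<close>.
  Real polynomials in \<open>x, y, z\<close> are the functions satisfying \<^const>\<open>real_polynomial_function\<close>.
\<close>

text \<open>\<open>f\<close> is the objective, \<open>S\<close> the feasible set.\<close>

definition local_minimum_point ::
    "('a::topological_space \<Rightarrow> real) \<Rightarrow> 'a set \<Rightarrow> 'a \<Rightarrow> bool"
  where "local_minimum_point f S w \<longleftrightarrow>
    w \<in> S \<and> (\<exists>V. open V \<and> w \<in> V \<and> (\<forall>u \<in> S \<inter> V. f u \<ge> f w))"

text \<open>
  \<^const>\<open>deriv\<close> is a choice operator, hence meaningful only where the partial derivative exists;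
  for polynomials this is everywhere.
\<close>

definition partial_deriv :: "'n::finite \<Rightarrow> (real ^ 'n \<Rightarrow> real) \<Rightarrow> real ^ 'n \<Rightarrow> real"
  where "partial_deriv i f w = deriv (\<lambda>t. f (w + t *\<^sub>R axis i 1)) 0"

end

theory Submission
  imports Defs "HOL-Computational_Algebra.Polynomial"
begin

text \<open>
  The heart of the matter is that a polynomial \<open>p\<close> on \<open>\<real>\<^sup>n\<close> is locally constant on its critical set: near
  every point \<open>w\<close>, all critical points \<open>v\<close> satisfy \<open>p v = p w\<close> (\<open>critical_values_locally_constant\<close>).
  Granted this, the critical points near a local minimum point \<open>w\<close> lie on the level set of \<open>p\<close>
  through \<open>w\<close>, where the first coordinate is by hypothesis at least that of \<open>w\<close>; and \<open>w\<close> is itself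
  critical by Fermat's rule.

  Local constancy can fail for smooth functions, so its proof has to use algebra. Suppose that
  critical points \<open>u\<^sub>k\<close> tend to \<open>w\<close> while \<open>p u\<^sub>k \<noteq> p w\<close>. In the field \<open>K\<close> of real sequences modulo
  a free ultrafilter, the sequence gives a point \<open>X \<in> K\<^sup>n\<close> and a value \<open>c = p X\<close> such that all
  partial derivatives of \<open>p\<close> vanish at \<open>X\<close>. The value \<open>c\<close> is transcendental over \<open>\<real>\<close>: a nonzero real
  polynomial has only finitely many roots, so it has no root other than \<open>p w\<close> itself near
  \<open>p w = lim p u\<^sub>k\<close>. Hence \<open>\<real>[c]\<close> carries the derivation \<open>d/dc\<close>, which kills the constants and sends
  \<open>c\<close> to \<open>1\<close> (\<open>derivation_along_convergent_sequence\<close>). In characteristic zero every derivation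
  extends to a subring containing the finitely many coordinates \<open>X\<^sub>i\<close>
  (\<open>derivation_extends_to_finite_set\<close>). For the extension \<open>D\<close>, the chain rule
  (\<open>hyper_chain_rule\<close>) gives \<open>1 = D c = (\<Sum>i. (\<partial>\<^sub>i p) X * D X\<^sub>i) = 0\<close>, a contradiction.
\<close>

section \<open>Derivations on subrings of a field of characteristic zero\<close>

text \<open>
  The derivation takes its values in the surrounding field rather than in \<open>B\<close>, because adjoining
  an algebraic element forces a division. Outside of \<open>B\<close>, the function \<open>D\<close> is arbitrary.
\<close>

locale derivation_on =
  fixes B :: "'a::field_char_0 set" and D :: "'a \<Rightarrow> 'a"
  assumes one_mem: "1 \<in> B"
    and diff_mem: "x \<in> B \<Longrightarrow> y \<in> B \<Longrightarrow> x - y \<in> B"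
    and mult_mem: "x \<in> B \<Longrightarrow> y \<in> B \<Longrightarrow> x * y \<in> B"
    and diff: "x \<in> B \<Longrightarrow> y \<in> B \<Longrightarrow> D (x - y) = D x - D y"
    and mult: "x \<in> B \<Longrightarrow> y \<in> B \<Longrightarrow> D (x * y) = D x * y + x * D y"
begin

lemma zero_mem: "0 \<in> B"
  using diff_mem[OF one_mem one_mem] by simp

lemma zero: "D 0 = 0"
  using diff[OF one_mem one_mem] by simp

lemma add_mem: "x \<in> B \<Longrightarrow> y \<in> B \<Longrightarrow> x + y \<in> B"
  using diff_mem[OF _ diff_mem[OF zero_mem], of x y] by simp

lemma add: "x \<in> B \<Longrightarrow> y \<in> B \<Longrightarrow> D (x + y) = D x + D y"
  using diff[OF _ diff_mem[OF zero_mem], of x y] diff[OF zero_mem, of y] zero by simp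

lemma one: "D 1 = 0"
  using mult[OF one_mem one_mem] by simp

lemma sum_mem: "(\<And>i. i \<in> I \<Longrightarrow> f i \<in> B) \<Longrightarrow> (\<Sum>i\<in>I. f i) \<in> B"
  by (induction I rule: infinite_finite_induct) (auto simp: zero_mem intro: add_mem)

lemma sum: "(\<And>i. i \<in> I \<Longrightarrow> f i \<in> B) \<Longrightarrow> D (\<Sum>i\<in>I. f i) = (\<Sum>i\<in>I. D (f i))"
  by (induction I rule: infinite_finite_induct) (auto simp: zero add sum_mem)

lemma of_nat_mem: "of_nat n \<in> B"
  by (induction n) (auto simp: zero_mem one_mem intro: add_mem)

definition polys :: "'a poly set"
  where "polys = {G. \<forall>i. coeff G i \<in> B}"

lemma const_polys: "b \<in> B \<Longrightarrow> [:b:] \<in> polys"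
  by (auto simp: polys_def coeff_pCons zero_mem split: nat.split)

lemma monom_polys: "b \<in> B \<Longrightarrow> monom b n \<in> polys"
  by (auto simp: polys_def zero_mem)

lemma diff_polys: "F \<in> polys \<Longrightarrow> G \<in> polys \<Longrightarrow> F - G \<in> polys"
  by (auto simp: polys_def diff_mem)

lemma mult_polys: "F \<in> polys \<Longrightarrow> G \<in> polys \<Longrightarrow> F * G \<in> polys"
  by (auto simp: polys_def coeff_mult intro!: sum_mem mult_mem)

lemma pderiv_polys: "F \<in> polys \<Longrightarrow> pderiv F \<in> polys"
  by (auto simp: polys_def coeff_pderiv simp del: of_nat_Suc intro!: mult_mem of_nat_mem)

text \<open>
  If \<open>D\<close> extends to \<open>B[a]\<close> with \<open>D a = d\<close>, then the Leibniz rule leaves this as the only possible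
  value of the extension at \<open>G(a)\<close>.
\<close>

definition induced_deriv :: "'a \<Rightarrow> 'a \<Rightarrow> 'a poly \<Rightarrow> 'a"
  where "induced_deriv a d G = poly (map_poly D G) a + poly (pderiv G) a * d"

lemma induced_deriv_diff:
  assumes "F \<in> polys" "G \<in> polys"
  shows "induced_deriv a d (F - G) = induced_deriv a d F - induced_deriv a d G"
proof -
  have "map_poly D (F - G) = map_poly D F - map_poly D G"
    using assms by (intro poly_eqI) (auto simp: coeff_map_poly zero diff polys_def)
  then show ?thesis by (simp only: induced_deriv_def pderiv_diff poly_diff) (simp add: algebra_simps)
qed

lemma induced_deriv_mult:
  assumes "F \<in> polys" "G \<in> polys"
  shows "induced_deriv a d (F * G) = induced_deriv a d F * poly G a + poly F a * induced_deriv a d G"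
proof -
  have "map_poly D (F * G) = map_poly D F * G + F * map_poly D G"
    using assms
    by (intro poly_eqI)
      (auto simp: coeff_map_poly zero coeff_mult polys_def sum mult mult_mem sum.distrib)
  then show ?thesis by (simp add: induced_deriv_def pderiv_mult algebra_simps)
qed

lemma induced_deriv_const: "induced_deriv a d [:b:] = D b"
  by (simp add: induced_deriv_def map_poly_pCons zero)

lemma induced_deriv_X: "induced_deriv a d (monom 1 1) = d"
  by (simp add: induced_deriv_def map_poly_monom zero one pderiv_monom poly_monom)

text \<open>
  The forced values define an extension as soon as they depend on \<open>G(a)\<close> only. By additivity this
  needs to be known just for the polynomials that vanish at \<open>a\<close>.
\<close>

lemma extend_by_value:
  assumes wd: "\<And>G. G \<in> polys \<Longrightarrow> poly G a = 0 \<Longrightarrow> induced_deriv a d G = 0"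
  obtains B' D' where "derivation_on B' D'" "B \<subseteq> B'" "\<And>b. b \<in> B \<Longrightarrow> D' b = D b"
    "a \<in> B'" "D' a = d"
proof -
  define B' where "B' = (\<lambda>G. poly G a) ` polys"
  define D' where "D' u = induced_deriv a d (SOME G. G \<in> polys \<and> poly G a = u)" for u
  have D': "D' (poly G a) = induced_deriv a d G" if G: "G \<in> polys" for G
  proof -
    define H where "H = (SOME H. H \<in> polys \<and> poly H a = poly G a)"
    have H: "H \<in> polys \<and> poly H a = poly G a"
      unfolding H_def by (rule someI[of _ G]) (use G in auto)
    have "induced_deriv a d (H - G) = 0" using H G by (intro wd diff_polys) auto
    then show ?thesis using induced_deriv_diff[of H G] H G by (simp add: D'_def H_def)
  qed
  show ?thesis
  proof
    show "derivation_on B' D'"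
    proof
      show "1 \<in> B'" using const_polys[OF one_mem] by (force simp: B'_def)
      fix x y assume "x \<in> B'" "y \<in> B'"
      then obtain F G where FG: "F \<in> polys" "G \<in> polys" "x = poly F a" "y = poly G a"
        by (auto simp: B'_def)
      have m: "x - y = poly (F - G) a" "x * y = poly (F * G) a" using FG by auto
      show "x - y \<in> B'" "x * y \<in> B'"
        using FG diff_polys mult_polys unfolding m B'_def by blast+
      show "D' (x - y) = D' x - D' y"
        unfolding m using FG by (simp only: D' diff_polys induced_deriv_diff)
      show "D' (x * y) = D' x * y + x * D' y"
        unfolding m using FG by (simp only: D' mult_polys induced_deriv_mult)
    qed
    show "B \<subseteq> B'" 
    proof
      fix b assume "b \<in> B"
      then show "b \<in> B'" using const_polys[of b] by (force simp: B'_def)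
    qed
    show "D' b = D b" if "b \<in> B" for b
      using D'[OF const_polys[OF that]] by (simp add: induced_deriv_const)
    have X: "monom 1 1 \<in> polys" by (rule monom_polys[OF one_mem])
    then show "a \<in> B'" by (force simp: B'_def poly_monom)
    show "D' a = d" using D'[OF X] by (simp only: induced_deriv_X) (simp add: poly_monom)
  qed
qed

text \<open>
  For transcendental \<open>a\<close> every \<open>d\<close> works. For algebraic \<open>a\<close>, let \<open>F\<close> vanish at \<open>a\<close> with minimal
  degree; then \<open>F'(a) \<noteq> 0\<close> by characteristic zero, and \<open>d\<close> is determined by the condition at \<open>F\<close>.
  The condition at any other \<open>G\<close> follows by reducing the degree of \<open>G\<close> with multiples of \<open>F\<close>, as in
  pseudo-division: the leading coefficient of \<open>F\<close> need not be invertible in \<open>B\<close>, but it is nonzero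
  in the field.
\<close>

lemma induced_deriv_well_defined:
  obtains d where "\<And>G. G \<in> polys \<Longrightarrow> poly G a = 0 \<Longrightarrow> induced_deriv a d G = 0"
proof (cases "\<exists>G \<in> polys. G \<noteq> 0 \<and> poly G a = 0")
  case False
  show ?thesis
    by (rule that[of 0]) (use False in \<open>auto simp: induced_deriv_def\<close>)
next
  case True
  then obtain F where F: "F \<in> polys" "F \<noteq> 0" "poly F a = 0"
    and min: "\<And>G. G \<in> polys \<Longrightarrow> G \<noteq> 0 \<Longrightarrow> poly G a = 0 \<Longrightarrow> degree F \<le> degree G"
    using ex_has_least_nat[of "\<lambda>G. G \<in> polys \<and> G \<noteq> 0 \<and> poly G a = 0" _ degree] by metis
  have deg: "degree F > 0"
  proof (rule ccontr)
    assume "\<not> degree F > 0"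
    then obtain c where "F = [:c:]" by (metis degree_eq_zeroE neq0_conv)
    then show False using F by auto
  qed
  have "poly (pderiv F) a \<noteq> 0"
  proof
    assume "poly (pderiv F) a = 0"
    moreover have "pderiv F \<noteq> 0" using deg by (simp add: pderiv_eq_0_iff)
    ultimately have "degree F \<le> degree (pderiv F)" using min F(1) pderiv_polys by blast
    then show False using deg by (simp add: degree_pderiv)
  qed
  define d where "d = - poly (map_poly D F) a / poly (pderiv F) a"
  have induced_deriv_F: "induced_deriv a d F = 0"
    using \<open>poly (pderiv F) a \<noteq> 0\<close> by (simp add: induced_deriv_def d_def)
  have "induced_deriv a d G = 0" if "G \<in> polys" "poly G a = 0" for G
    using that
  proof (induction "degree G" arbitrary: G rule: less_induct)
    case less
    show ?case
    proof (cases "G = 0")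
      case True
      then show ?thesis by (simp add: induced_deriv_def)
    next
      case False
      then have le: "degree F \<le> degree G" using min less.prems by blast
      \<comment> \<open>One step of pseudo-division, which cancels the leading term of \<open>G\<close>.\<close>
      define l where "l = lead_coeff F"
      define M where "M = monom (lead_coeff G) (degree G - degree F)"
      define G' where "G' = [:l:] * G - M * F"
      have "l \<in> B" "lead_coeff G \<in> B"
        using F less.prems by (auto simp: polys_def l_def)
      then have polys: "[:l:] \<in> polys" "M \<in> polys"
        unfolding M_def by (auto intro: const_polys monom_polys)
      then have polys': "[:l:] * G \<in> polys" "M * F \<in> polys"
        using F(1) less.prems(1) by (auto intro: mult_polys simp del: mult_pCons_left)
      have "degree G' < degree G"
      proof -
        have "degree (M * F) \<le> degree G"
          using degree_mult_le[of M F] le degree_monom_le[of "lead_coeff G" "degree G - degree F"]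
          by (simp add: M_def)
        then have "degree G' \<le> degree G"
          unfolding G'_def by (intro degree_diff_le) auto
        moreover have "coeff G' (degree G) = 0"
          using le by (simp add: G'_def M_def l_def coeff_monom_mult)
        ultimately show ?thesis using deg le
          by (metis eq_zero_or_degree_less degree_0 less_le_trans)
      qed
      then have "induced_deriv a d G' = 0"
        using less F polys' unfolding G'_def by (intro less.hyps diff_polys) auto
      then have "l * induced_deriv a d G = 0"
        using polys polys' F less.prems
        by (simp add: G'_def induced_deriv_diff induced_deriv_mult induced_deriv_F del: mult_pCons_left)
      then show ?thesis using F by (simp add: l_def)
    qed
  qed
  then show ?thesis by (rule that)
qed

end

lemma derivation_extends_to_finite_set:
  assumes "derivation_on B D" "finite A"
  shows "\<exists>B' D'. derivation_on B' D' \<and> B \<union> A \<subseteq> B' \<and> (\<forall>b\<in>B. D' b = D b)"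
  using assms(2)
proof (induction A)
  case empty
  then show ?case using assms(1) by auto
next
  case (insert a A)
  then obtain B1 D1 where 1: "derivation_on B1 D1" "B \<union> A \<subseteq> B1" "\<forall>b\<in>B. D1 b = D b" by auto
  obtain d where "\<And>G. G \<in> derivation_on.polys B1 \<Longrightarrow> poly G a = 0 \<Longrightarrow> derivation_on.induced_deriv D1 a d G = 0"
    using derivation_on.induced_deriv_well_defined[OF 1(1)] by metis
  from derivation_on.extend_by_value[OF 1(1) this]
  obtain B2 D2 where "derivation_on B2 D2" "B1 \<subseteq> B2" "\<And>b. b \<in> B1 \<Longrightarrow> D2 b = D1 b" "a \<in> B2"
    by metis
  with 1 show ?case by (intro exI[of _ B2] exI[of _ D2]) auto
qed

section \<open>A field of sequences modulo an ultrafilter\<close>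

text \<open>
  By Zorn's lemma there is a minimal proper filter below \<open>sequentially\<close>. It decides every predicate,
  since intersecting it with a set that it does not exclude leaves it proper, hence unchanged.
\<close>

lemma ultrafilter_exists:
  "\<exists>U \<le> sequentially. U \<noteq> bot \<and> (\<forall>P. eventually P U \<or> eventually (\<lambda>n. \<not> P n) U)"
proof -
  define A where "A = {G :: nat filter. G \<noteq> bot \<and> G \<le> sequentially}"
  have "\<exists>U\<in>A. \<forall>G\<in>A. U \<ge> G \<longrightarrow> G = U"
  proof (rule predicate_Zorn[where P = "\<lambda>G H. H \<le> G"])
    show "partial_order_on A (relation_of (\<lambda>G H. H \<le> G) A)"
      by (rule partial_order_on_relation_ofI) auto
    fix C assume C: "C \<in> Chains (relation_of (\<lambda>G H. H \<le> G) A)"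
    then have CA: "C \<subseteq> A" by (auto simp: Chains_def relation_of_def)
    show "\<exists>u\<in>A. \<forall>a\<in>C. u \<le> a"
    proof (cases "C = {}")
      case True
      then show ?thesis by (intro bexI[of _ sequentially]) (auto simp: A_def)
    next
      case False
      have "Inf C = bot \<longleftrightarrow> (\<exists>G\<in>C. G = bot)"
        unfolding trivial_limit_def using False C
        by (intro eventually_Inf_base) (auto simp: Chains_def relation_of_def)
      then have "Inf C \<noteq> bot" using CA by (auto simp: A_def)
      moreover obtain G where "G \<in> C" using False by blast
      then have "Inf C \<le> sequentially" using CA by (intro Inf_lower2[of G]) (auto simp: A_def)
      ultimately show ?thesis by (intro bexI[of _ "Inf C"]) (auto simp: A_def Inf_lower)
    qed
  qed
  then obtain U where U: "U \<noteq> bot" "U \<le> sequentially"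
    and max: "\<And>G. G \<noteq> bot \<Longrightarrow> G \<le> U \<Longrightarrow> G = U"
    unfolding A_def by (auto dest: order_trans)
  have "eventually P U" if "\<not> eventually (\<lambda>n. \<not> P n) U" for P
  proof -
    have "inf U (principal {n. P n}) \<noteq> bot"
      using that by (simp add: trivial_limit_def eventually_inf_principal)
    then have "inf U (principal {n. P n}) = U" by (intro max) auto
    moreover have "eventually P (inf U (principal {n. P n}))"
      by (simp add: eventually_inf_principal)
    ultimately show ?thesis by simp
  qed
  then show ?thesis using U by blast
qed

definition ultra :: "nat filter"
  where "ultra = (SOME U. U \<le> sequentially \<and> U \<noteq> bot \<and>
    (\<forall>P. eventually P U \<or> eventually (\<lambda>n. \<not> P n) U))"

lemma ultra_le: "ultra \<le> sequentially"
  and ultra_nontrivial: "ultra \<noteq> bot"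
  and ultra_cases: "eventually P ultra \<or> eventually (\<lambda>n. \<not> P n) ultra"
  using someI_ex[OF ultrafilter_exists] unfolding ultra_def[symmetric] by auto

text \<open>
  The ultrafilter property makes the ring of real sequences modulo \<open>ultra\<close> a field: a sequence that
  is not almost everywhere zero is almost everywhere nonzero, hence invertible.
\<close>

quotient_type hyper = "nat \<Rightarrow> real" / "\<lambda>X Y. eventually (\<lambda>n. X n = Y n) ultra"
  by (intro equivpI reflpI sympI transpI) (auto elim: eventually_elim2 simp: eq_commute)

instantiation hyper :: field
begin

lift_definition zero_hyper :: hyper is "\<lambda>n. 0" .
lift_definition one_hyper :: hyper is "\<lambda>n. 1" .
lift_definition plus_hyper :: "hyper \<Rightarrow> hyper \<Rightarrow> hyper" is "\<lambda>X Y n. X n + Y n"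
  by (auto elim: eventually_elim2)
lift_definition minus_hyper :: "hyper \<Rightarrow> hyper \<Rightarrow> hyper" is "\<lambda>X Y n. X n - Y n"
  by (auto elim: eventually_elim2)
lift_definition times_hyper :: "hyper \<Rightarrow> hyper \<Rightarrow> hyper" is "\<lambda>X Y n. X n * Y n"
  by (auto elim: eventually_elim2)
lift_definition divide_hyper :: "hyper \<Rightarrow> hyper \<Rightarrow> hyper" is "\<lambda>X Y n. X n / Y n"
  by (auto elim: eventually_elim2)
lift_definition uminus_hyper :: "hyper \<Rightarrow> hyper" is "\<lambda>X n. - X n"
  by (auto elim: eventually_mono)
lift_definition inverse_hyper :: "hyper \<Rightarrow> hyper" is "\<lambda>X n. inverse (X n)"
  by (auto elim: eventually_mono)

instance
proof
  fix a b c :: hyper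
  show "inverse a * a = 1" if "a \<noteq> 0"
    using that
  proof transfer
    fix X assume "\<not> eventually (\<lambda>n. X n = (0::real)) ultra"
    then have "eventually (\<lambda>n. X n \<noteq> 0) ultra" using ultra_cases by blast
    then show "eventually (\<lambda>n. inverse (X n) * X n = 1) ultra" by eventually_elim simp
  qed
  show "(0::hyper) \<noteq> 1" by transfer (simp add: ultra_nontrivial)
qed (transfer, simp add: algebra_simps divide_inverse)+

end

instance hyper :: field_char_0
proof
  show "inj (of_nat :: nat \<Rightarrow> hyper)"
  proof (rule injI)
    fix k m :: nat
    have of_nat: "of_nat j = abs_hyper (\<lambda>n. real j)" for j
      by (induction j) (simp_all add: zero_hyper_def one_hyper_def plus_hyper.abs_eq)
    assume "(of_nat k :: hyper) = of_nat m"
    then show "k = m"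
      unfolding of_nat by (simp add: hyper.abs_eq_iff ultra_nontrivial)
  qed
qed

section \<open>Critical values are isolated\<close>

abbreviation hyper_const :: "real \<Rightarrow> hyper"
  where "hyper_const r \<equiv> abs_hyper (\<lambda>n. r)"

lemma poly_abs_hyper:
  "poly (map_poly hyper_const q) (abs_hyper X) = abs_hyper (\<lambda>n. poly q (X n))"
proof (induction q)
  case 0
  show ?case by (simp add: zero_hyper_def)
next
  case (pCons a q)
  have "map_poly hyper_const (pCons a q) = pCons (hyper_const a) (map_poly hyper_const q)"
    by (intro map_poly_pCons) (simp add: zero_hyper_def)
  then show ?case
    by (simp only: poly_pCons pCons.IH plus_hyper.abs_eq times_hyper.abs_eq)
qed

lemma partial_deriv_works:
  assumes "real_polynomial_function f"
  shows "((\<lambda>t. f (w + t *\<^sub>R axis i 1)) has_real_derivative partial_deriv i f w) (at 0)"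
proof -
  have "f differentiable (at (w + 0 *\<^sub>R axis i 1))"
    using assms differentiable_at_real_polynomial_function by blast
  then have "(\<lambda>t. f (w + t *\<^sub>R axis i 1)) differentiable (at 0)"
    using differentiable_chain_at[of "\<lambda>t. w + t *\<^sub>R axis i 1" 0 f] by (simp add: o_def)
  then show ?thesis
    unfolding partial_deriv_def
    by (simp add: DERIV_deriv_iff_real_differentiable)
qed

lemma partial_deriv_linear:
  assumes "bounded_linear f"
  shows "partial_deriv i f w = f (axis i 1)"
proof -
  interpret bounded_linear f by fact
  show ?thesis
    unfolding partial_deriv_def add scaleR
    by (intro DERIV_imp_deriv) (auto intro!: derivative_eq_intros)
qed

lemma partial_deriv_const: "partial_deriv i (\<lambda>_. c) w = 0"
  by (simp add: partial_deriv_def)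

lemma partial_deriv_add:
  assumes "real_polynomial_function f" "real_polynomial_function g"
  shows "partial_deriv i (\<lambda>v. f v + g v) w = partial_deriv i f w + partial_deriv i g w"
  unfolding partial_deriv_def[of i "\<lambda>v. f v + g v"]
  by (intro DERIV_imp_deriv DERIV_add partial_deriv_works assms)

lemma partial_deriv_mult:
  assumes "real_polynomial_function f" "real_polynomial_function g"
  shows "partial_deriv i (\<lambda>v. f v * g v) w = partial_deriv i f w * g w + f w * partial_deriv i g w"
  unfolding partial_deriv_def[of i "\<lambda>v. f v * g v"]
  using DERIV_mult[OF partial_deriv_works[OF assms(1), of w i] partial_deriv_works[OF assms(2), of w i]]
  by (intro DERIV_imp_deriv) (simp add: algebra_simps)

lemma abs_hyper_sum: "abs_hyper (\<lambda>n. \<Sum>i\<in>I. X i n) = (\<Sum>i\<in>I. abs_hyper (X i))"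
proof (induction I rule: infinite_finite_induct)
  case (insert i I)
  then show ?case by (simp only: sum.insert[OF insert.hyps] flip: insert.IH plus_hyper.abs_eq)
qed (simp_all add: zero_hyper.abs_eq)

text \<open>
  Membership in \<open>B\<close> is proved along with the rule because the product case needs it for
  the Leibniz rule of \<open>D\<close>.
\<close>

lemma hyper_chain_rule:
  fixes u :: "nat \<Rightarrow> real ^ 'n::finite"
  assumes "derivation_on B D"
    and const_mem: "\<And>r. hyper_const r \<in> B" and D_const: "\<And>r. D (hyper_const r) = 0"
    and coord_mem: "\<And>i. abs_hyper (\<lambda>n. u n $ i) \<in> B"
    and "real_polynomial_function f"
  shows "abs_hyper (\<lambda>n. f (u n)) \<in> B \<and>
    D (abs_hyper (\<lambda>n. f (u n))) =
      (\<Sum>i\<in>UNIV. abs_hyper (\<lambda>n. partial_deriv i f (u n)) * D (abs_hyper (\<lambda>n. u n $ i)))"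
  using assms(5)
proof (induction rule: real_polynomial_function.induct)
  interpret d: derivation_on B D by fact
  let ?X = "\<lambda>i. abs_hyper (\<lambda>n. u n $ i)"
  {
    case (linear f)
    interpret f: bounded_linear f by fact
    \<comment> \<open>A linear form is a combination of coordinates whose coefficients \<open>D\<close> treats as constants.\<close>
    have f_eq: "f v = (\<Sum>i\<in>UNIV. f (axis i 1) * v $ i)" for v
    proof -
      have "f v = f (\<Sum>i\<in>UNIV. v $ i *\<^sub>R axis i 1)"
        by (simp only: basis_expansion flip: scalar_mult_eq_scaleR)
      then show ?thesis by (simp only: f.sum f.scaleR real_scaleR_def mult.commute)
    qed
    have eq: "abs_hyper (\<lambda>n. f (u n)) = (\<Sum>i\<in>UNIV. hyper_const (f (axis i 1)) * ?X i)"
      by (subst f_eq) (simp only: abs_hyper_sum times_hyper.abs_eq)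
    have mem: "hyper_const (f (axis i 1)) * ?X i \<in> B" for i
      by (intro d.mult_mem const_mem coord_mem)
    have "D (hyper_const (f (axis i 1)) * ?X i) = hyper_const (f (axis i 1)) * D (?X i)" for i
      by (simp add: d.mult const_mem coord_mem D_const)
    then show ?case
      unfolding eq partial_deriv_linear[OF linear] d.sum[OF mem]
      using d.sum_mem[OF mem] by simp
  next
    case (const c)
    then show ?case
      by (simp add: const_mem D_const partial_deriv_const flip: zero_hyper_def)
  next
    case (add f g)
    have "abs_hyper (\<lambda>n. partial_deriv i (\<lambda>v. f v + g v) (u n)) =
        abs_hyper (\<lambda>n. partial_deriv i f (u n)) + abs_hyper (\<lambda>n. partial_deriv i g (u n))" for i
      using add.hyps by (simp add: partial_deriv_add plus_hyper.abs_eq)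
    moreover have "abs_hyper (\<lambda>n. f (u n) + g (u n)) = abs_hyper (\<lambda>n. f (u n)) + abs_hyper (\<lambda>n. g (u n))"
      by (simp add: plus_hyper.abs_eq)
    ultimately show ?case
      using add.IH by (simp add: d.add_mem d.add distrib_right sum.distrib)
  next
    case (mult f g)
    let ?f = "abs_hyper (\<lambda>n. f (u n))" and ?g = "abs_hyper (\<lambda>n. g (u n))"
    let ?df = "\<lambda>i. abs_hyper (\<lambda>n. partial_deriv i f (u n))"
    let ?dg = "\<lambda>i. abs_hyper (\<lambda>n. partial_deriv i g (u n))"
    have "abs_hyper (\<lambda>n. partial_deriv i (\<lambda>v. f v * g v) (u n)) = ?df i * ?g + ?f * ?dg i" for i
      using mult.hyps by (simp add: partial_deriv_mult plus_hyper.abs_eq times_hyper.abs_eq)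
    then have "(\<Sum>i\<in>UNIV. abs_hyper (\<lambda>n. partial_deriv i (\<lambda>v. f v * g v) (u n)) * D (?X i)) =
        (\<Sum>i\<in>UNIV. ?df i * D (?X i)) * ?g + ?f * (\<Sum>i\<in>UNIV. ?dg i * D (?X i))"
      by (simp add: sum_distrib_left sum_distrib_right sum.distrib algebra_simps)
    moreover have "abs_hyper (\<lambda>n. f (u n) * g (u n)) = ?f * ?g"
      by (simp add: times_hyper.abs_eq)
    ultimately show ?case
      using mult.IH by (simp add: d.mult_mem d.mult)
  }
qed

lemma not_root_near:
  fixes q :: "real poly"
  assumes "q \<noteq> 0" "c \<longlonglongrightarrow> l" "\<And>n. c n \<noteq> l"
  shows "eventually (\<lambda>n. poly q (c n) \<noteq> 0) sequentially"
proof -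
  have "finite ({x. poly q x = 0} - {l})" using poly_roots_finite[OF assms(1)] by simp
  then have "open (- ({x. poly q x = 0} - {l}))" by (intro open_Compl finite_imp_closed)
  from topological_tendstoD[OF assms(2) this] show ?thesis
    using assms(3) by (auto elim: eventually_mono)
qed

text \<open>
  Starting from the zero derivation on the real constants, any value may be prescribed at the class
  of \<open>c\<close>, because this class is transcendental over the reals: a real polynomial that annihilates it has
  roots \<open>c n \<noteq> l\<close> arbitrarily close to \<open>l\<close>, thus infinitely many roots, and must be zero.
\<close>

lemma derivation_along_convergent_sequence:
  fixes c :: "nat \<Rightarrow> real"
  assumes "c \<longlonglongrightarrow> l" "\<And>n. c n \<noteq> l"
  obtains B D where "derivation_on B D" "\<And>r. hyper_const r \<in> B" "\<And>r. D (hyper_const r) = 0"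
    "abs_hyper c \<in> B" "D (abs_hyper c) = 1"
proof -
  let ?R = "range hyper_const"
  interpret derivation_on ?R "\<lambda>_. 0"
    by unfold_locales
      (auto simp: one_hyper_def zero_hyper_def minus_hyper.abs_eq times_hyper.abs_eq)
  have "induced_deriv (abs_hyper c) 1 G = 0" if G: "G \<in> polys" "poly G (abs_hyper c) = 0" for G
  proof -
    have "\<exists>q. G = map_poly hyper_const q"
      using G(1)
    proof (induction G)
      case 0
      then show ?case by (intro exI[of _ 0]) simp
    next
      case (pCons a G)
      have "coeff (pCons a G) 0 \<in> ?R" "\<And>i. coeff (pCons a G) (Suc i) \<in> ?R"
        using pCons.prems unfolding polys_def by blast+
      then obtain r q where "a = hyper_const r" "G = map_poly hyper_const q"
        using pCons.IH by (auto simp: polys_def)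
      then show ?case
        by (intro exI[of _ "pCons r q"]) (simp add: map_poly_pCons zero_hyper_def)
    qed
    then obtain q where q: "G = map_poly hyper_const q" ..
    have "q = 0"
    proof (rule ccontr)
      assume "q \<noteq> 0"
      then have "eventually (\<lambda>n. poly q (c n) \<noteq> 0) ultra"
        using not_root_near assms ultra_le filter_leD by blast
      moreover have "eventually (\<lambda>n. poly q (c n) = 0) ultra"
        using G(2) by (simp add: q poly_abs_hyper zero_hyper_def hyper.abs_eq_iff)
      ultimately have "eventually (\<lambda>n. False) ultra" by eventually_elim simp
      then show False using ultra_nontrivial by simp
    qed
    then show ?thesis by (simp add: q induced_deriv_def)
  qed
  then obtain B D where "derivation_on B D" "?R \<subseteq> B" "\<And>b. b \<in> ?R \<Longrightarrow> D b = 0"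
    "abs_hyper c \<in> B" "D (abs_hyper c) = 1"
    using extend_by_value[of "abs_hyper c" 1] by metis
  then show ?thesis by (intro that[of B D]) auto
qed

text \<open>
  This is the local form of the theorem that a polynomial has finitely many critical values.
\<close>

theorem critical_values_locally_constant:
  fixes p :: "real ^ 'n::finite \<Rightarrow> real"
  assumes p: "real_polynomial_function p"
  shows "eventually (\<lambda>v. (\<forall>i. partial_deriv i p v = 0) \<longrightarrow> p v = p w) (nhds w)"
proof (rule ccontr)
  assume "\<not> ?thesis"
  then have "\<exists>v. dist v w < e \<and> (\<forall>i. partial_deriv i p v = 0) \<and> p v \<noteq> p w" if "e > 0" for e
    using that unfolding eventually_nhds_metric by auto
  then have "\<exists>v. dist v w < inverse (real (Suc n)) \<and> (\<forall>i. partial_deriv i p v = 0) \<and> p v \<noteq> p w" for n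
    by simp
  then obtain u where u: "\<And>n. dist (u n) w < inverse (real (Suc n))"
    and crit: "\<And>n i. partial_deriv i p (u n) = 0" and neq: "\<And>n. p (u n) \<noteq> p w"
    by metis
  have "(\<lambda>n. dist (u n) w) \<longlonglongrightarrow> 0"
    by (rule tendsto_sandwich[OF _ _ tendsto_const LIMSEQ_inverse_real_of_nat])
      (use u in \<open>auto intro!: always_eventually less_imp_le simp del: of_nat_Suc\<close>)
  then have "u \<longlonglongrightarrow> w" by (rule tendsto_dist_iff[THEN iffD2])
  then have "(\<lambda>n. p (u n)) \<longlonglongrightarrow> p w"
    using continuous_real_polymonial_function[OF p, of w] isCont_tendsto_compose by blast
  from derivation_along_convergent_sequence[OF this neq]
  obtain B D where BD: "derivation_on B D" "\<And>r. hyper_const r \<in> B" "\<And>r. D (hyper_const r) = 0"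
    "abs_hyper (\<lambda>n. p (u n)) \<in> B" "D (abs_hyper (\<lambda>n. p (u n))) = 1"
    by metis
  obtain B' D' where B': "derivation_on B' D'" "B \<union> range (\<lambda>i. abs_hyper (\<lambda>n. u n $ i)) \<subseteq> B'"
    "\<And>b. b \<in> B \<Longrightarrow> D' b = D b"
    using derivation_extends_to_finite_set[OF BD(1), of "range (\<lambda>i. abs_hyper (\<lambda>n. u n $ i))"]
    by auto
  have "D' (abs_hyper (\<lambda>n. p (u n))) =
      (\<Sum>i\<in>UNIV. abs_hyper (\<lambda>n. partial_deriv i p (u n)) * D' (abs_hyper (\<lambda>n. u n $ i)))"
    using B' BD by (intro hyper_chain_rule[OF B'(1) _ _ _ p, THEN conjunct2]) auto
  also have "\<dots> = 0" by (simp add: crit zero_hyper_def[symmetric])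
  finally show False using B'(3) BD(4,5) by simp
qed

theorem lemma1:
  fixes p :: "real ^ 3 \<Rightarrow> real" and w :: "real ^ 3"
  assumes "real_polynomial_function p"
    and "local_minimum_point p UNIV w"
    and "local_minimum_point (\<lambda>u. u $ 1) {u. p u = p w} w"
  shows "local_minimum_point (\<lambda>u. u $ 1)
           {u. partial_deriv 1 p u = 0 \<and> partial_deriv 2 p u = 0 \<and> partial_deriv 3 p u = 0} w"
proof -
  have crit: "partial_deriv i p w = 0" for i
  proof -
    obtain V where V: "open V" "w \<in> V" "\<And>v. v \<in> V \<Longrightarrow> p w \<le> p v"
      using assms(2) by (auto simp: local_minimum_point_def)
    have "((\<lambda>t. w + t *\<^sub>R axis i 1) \<longlongrightarrow> w + 0 *\<^sub>R axis i 1) (nhds 0)"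
      by (intro tendsto_intros) (simp add: filterlim_ident)
    then have "eventually (\<lambda>t. w + t *\<^sub>R axis i 1 \<in> V) (nhds (0::real))"
      using V(1,2) by (auto dest: topological_tendstoD)
    then obtain e where "e > 0" "\<And>t. \<bar>t\<bar> < e \<Longrightarrow> w + t *\<^sub>R axis i 1 \<in> V"
      by (auto simp: eventually_nhds_metric dist_real_def)
    then show ?thesis
      using V(3) by (intro DERIV_local_min[OF partial_deriv_works[OF assms(1)], of e]) auto
  qed
  obtain V where V: "open V" "w \<in> V" "\<And>v. v \<in> V \<Longrightarrow> \<forall>i. partial_deriv i p v = 0 \<Longrightarrow> p v = p w"
    using critical_values_locally_constant[OF assms(1), of w] by (auto simp: eventually_nhds)
  obtain V' where V': "open V'" "w \<in> V'" "\<And>v. v \<in> V' \<Longrightarrow> p v = p w \<Longrightarrow> w $ 1 \<le> v $ 1"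
    using assms(3) by (auto simp: local_minimum_point_def)
  show ?thesis
    unfolding local_minimum_point_def
  proof (intro conjI exI[of _ "V \<inter> V'"] ballI)
    fix v assume "v \<in> {u. partial_deriv 1 p u = 0 \<and> partial_deriv 2 p u = 0 \<and> partial_deriv 3 p u = 0} \<inter> (V \<inter> V')"
    then show "w $ 1 \<le> v $ 1" using V(3) V'(3) by (auto simp: forall_3)
  qed (use V(1,2) V'(1,2) crit in auto)
qed

end
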